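(* Let $\bar\rho\in\mathcal{P}_c(\mathbb{R})$ with $\|\bar\rho\|_{L^\infty(\mathbb{R})}\le1/2$. Assume that $v$ satisfies (V1). For every integer $N\ge1$ define $x^N_0(0):=\inf(\mathrm{supp}(\bar\rho))$ and recursively $$x^N_j(0):=\sup\left\{x\in\mathbb{R}:\ \int_{x^N_{j-1}(0)}^x\bar\rho(y)\,dy<\frac1N\right\},\qquad j=1,\dots,N,$$ and define $$\tilde x_j^N(0)=\begin{cases}x_j^N(0)&\text{if } j\text{ is even or } j=N,\\[4pt] \dfrac{x_{j-1}^N(0)+x_j^N(0)}{2}&\text{if } j<N\text{ is odd}.\end{cases}$$ Let $\tilde\rho^{E,N}(0)$ be the Eulerian discrete density at time $t=0$ corresponding to $\{\tilde x_j^N(0)\}_{j=0}^N$. Then: (i) $\tilde\rho^{E,N}(0)\rightharpoonup\bar\rho$ weak$^*$ in $L^\infty(\mathbb{R})$ as $N\to\infty$; (ii) $\tilde\rho^{E,N_k}(0)\nrightarrow\bar\rho$ in $L^1(\mathbb{R})$ for every subsequence $\{\tilde\rho^{E,N_k}(0)\}_k$; (iii) the sequence $\mathrm{TV}(\tilde\rho^{E,N}(0);\mathbb{R})$ is unbounded.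
   Context: $\mathcal{P}_c(\mathbb{R})$ is the set of (non-negative) Radon measures on $\mathbb{R}$ with compact support and total mass $1$; the condition $\|\bar\rho\|_{L^\infty}\le1/2$ means that $\bar\rho$ has a density (still denoted $\bar\rho$) bounded by $1/2$. $\mathrm{TV}(\cdot;\mathbb{R})$ denotes total variation on $\mathbb{R}$. (V1): $v:[0,1]\to\mathbb{R}$ is Lipschitz continuous, $v(1)=0$, and there is a constant $c<0$ with $v'(\rho)\le c$ for a.e. $\rho\in[0,1]$. Eulerian discrete density at time $0$ associated with positions $\tilde x_0^N(0)<\dots<\tilde x_N^N(0)$: $$\tilde\rho^{E,N}(0,x):=\sum_{j=0}^{N-1}\frac{1/N}{\tilde x^N_{j+1}(0)-\tilde x^N_j(0)}\,\chi_{[\tilde x^N_j(0),\tilde x^N_{j+1}(0))}(x),$$ where $\chi_A$ is the indicator function of $A$. *)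

theory Defs
  imports "HOL-Probability.Probability"
begin

definition measure_support :: "real measure \<Rightarrow> real set" where
  "measure_support \<mu> = {x. \<forall>U. open U \<and> x \<in> U \<longrightarrow> emeasure \<mu> U > 0}"

text \<open>A finite Borel measure on the real line is automatically Radon.\<close>

definition prob_compact_support :: "real measure set" where
  "prob_compact_support =
     {\<mu>. prob_space \<mu> \<and> sets \<mu> = sets borel \<and> compact (measure_support \<mu>)}"

text \<open>The sign condition is not implied by the last conjunct, since \<^const>\<open>ennreal\<close> truncates
  negative numbers to \<open>0\<close>.\<close>

definition is_density :: "real measure \<Rightarrow> (real \<Rightarrow> real) \<Rightarrow> bool" where
  "is_density \<mu> f \<longleftrightarrow>
     f \<in> borel_measurable lborel \<and> (AE x in lborel. 0 \<le> f x) \<and>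
     \<mu> = density lborel (\<lambda>x. ennreal (f x))"

definition Linfty_norm :: "(real \<Rightarrow> real) \<Rightarrow> ereal" where
  "Linfty_norm f = esssup lborel (\<lambda>x. ereal \<bar>f x\<bar>)"

definition in_Linfty :: "(real \<Rightarrow> real) \<Rightarrow> bool" where
  "in_Linfty f \<longleftrightarrow> f \<in> borel_measurable lborel \<and> Linfty_norm f < \<infinity>"

definition V1 :: "(real \<Rightarrow> real) \<Rightarrow> bool" where
  "V1 v \<longleftrightarrow>
     (\<exists>L. L-lipschitz_on {0..1} v) \<and> v 1 = 0 \<and>
     (\<exists>c<0. AE r in lborel. r \<in> {0..1} \<longrightarrow>
        (\<exists>D. (v has_real_derivative D) (at r within {0..1}) \<and> D \<le> c))"

text \<open>The integral is oriented: it is negative for points to the left of the lower limit.\<close>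

primrec quantile_pos :: "real measure \<Rightarrow> (real \<Rightarrow> real) \<Rightarrow> nat \<Rightarrow> nat \<Rightarrow> real" where
  "quantile_pos \<mu> \<rho> N 0 = Inf (measure_support \<mu>)"
| "quantile_pos \<mu> \<rho> N (Suc j) =
     Sup {x. (LBINT y=ereal (quantile_pos \<mu> \<rho> N j)..ereal x. \<rho> y) < 1 / real N}"

definition modified_pos :: "(nat \<Rightarrow> real) \<Rightarrow> nat \<Rightarrow> nat \<Rightarrow> real" where
  "modified_pos x N j = (if even j \<or> j = N then x j else (x (j - 1) + x j) / 2)"

definition eulerian_density :: "nat \<Rightarrow> (nat \<Rightarrow> real) \<Rightarrow> real \<Rightarrow> real" where
  "eulerian_density N y x =
     (\<Sum>j<N. (1 / real N) / (y (Suc j) - y j) * indicator {y j..<y (Suc j)} x)"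

definition weak_star_tendsto :: "(nat \<Rightarrow> real \<Rightarrow> real) \<Rightarrow> (real \<Rightarrow> real) \<Rightarrow> bool" where
  "weak_star_tendsto f g \<longleftrightarrow>
     (\<forall>n. in_Linfty (f n)) \<and> in_Linfty g \<and>
     (\<forall>\<phi>. integrable lborel \<phi> \<longrightarrow>
        (\<lambda>n. LINT x|lborel. f n x * \<phi> x) \<longlonglongrightarrow> (LINT x|lborel. g x * \<phi> x))"

text \<open>Using the nonnegative integral, a difference outside \<open>L\<^sup>1\<close> counts as having infinite norm.\<close>

definition L1_tendsto :: "(nat \<Rightarrow> real \<Rightarrow> real) \<Rightarrow> (real \<Rightarrow> real) \<Rightarrow> bool" where
  "L1_tendsto f g \<longleftrightarrow> (\<lambda>n. \<integral>\<^sup>+ x. ennreal \<bar>f n x - g x\<bar> \<partial>lborel) \<longlonglongrightarrow> 0"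

text \<open>Pointwise variation. For right-continuous functions with left limits, such as
  \<^const>\<open>eulerian_density\<close>, it equals the variation of the distributional derivative.\<close>

definition total_variation :: "(real \<Rightarrow> real) \<Rightarrow> ennreal" where
  "total_variation f =
     (SUP (n, t) \<in> {(n :: nat, t :: nat \<Rightarrow> real). mono t}.
        \<Sum>i<n. ennreal \<bar>f (t (Suc i)) - f (t i)\<bar>)"

text \<open>At \<open>N = 0\<close> this is the zero function, so that indexing sequences by all natural numbers
  is harmless.\<close>

definition initial_density :: "real measure \<Rightarrow> (real \<Rightarrow> real) \<Rightarrow> nat \<Rightarrow> real \<Rightarrow> real" where
  "initial_density \<mu> \<rho> N = eulerian_density N (modified_pos (quantile_pos \<mu> \<rho> N) N)"

end

theory Submission
  imports Defs
begin

text \<open>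
  Let \<open>F\<close> be the distribution function of \<open>\<mu>\<close>. It is Lipschitz with constant \<open>1/2\<close>, so the points
  \<open>x\<^sub>j\<close> satisfy \<open>F x\<^sub>j = j/N\<close> exactly and consecutive ones are at least \<open>2/N\<close> apart, while all of
  them lie in the convex hull of the support, whose length \<open>L\<close> does not depend on \<open>N\<close>. The proof
  plays these two facts off against each other: the gaps are not too short individually and not too
  long on average, so a definite fraction of them has length comparable to \<open>1/N\<close>.

  The modification moves every odd node before the last one to the middle of the gap on its left. The discrete density
  puts mass \<open>1/N\<close> in every cell, hence its distribution function has the value \<open>j/N\<close> at the \<open>j\<close>-th
  modified node, where \<open>F\<close> differs from \<open>j/N\<close> by at most \<open>1/N\<close>. The two monotone functions are thus
  within \<open>2/N\<close> of each other (\<open>eulerian_density_cdf_close\<close>). All discrete densities are bounded by \<open>1\<close> and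
  vanish outside the same interval, so convergence of the distribution functions is weak* convergence
  (\<open>weak_star_tendstoI\<close>).

  Consider now a pair of consecutive gaps of lengths \<open>l\<close> and \<open>l'\<close>, starting at an even index, and put
  \<open>t = N l\<close> and \<open>t' = N l'\<close>; both are at least \<open>2\<close>. On the left half of the first gap the discrete
  density is \<open>2/t\<close>, on the rest of the pair it is \<open>2/(2t' + t)\<close>.

  For the \<open>L\<^sup>1\<close> distance, compare masses on the first gap: \<open>\<mu>\<close> has mass \<open>1/N\<close> there, the discrete
  density has the additional mass \<open>(1/N) t/(2t' + t)\<close>, which is at least \<open>(1/N)/(t' + 1)\<close>
  (\<open>excess_ge\<close>). Distinct pairs contribute on disjoint sets, so the distance is at least the sum of
  these quantities. For the total variation, the downward jump inside the pair is at least
  \<open>8/(t + 2)\<^sup>2\<close> (\<open>jump_ge\<close>).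

  Both lower bounds are convex functions of \<open>t'\<close> and \<open>t\<close>, whose averages over the pairs are bounded in
  terms of \<open>L\<close> (\<open>pair_sums\<close>). By convexity the sum over the \<open>N div 2\<close> pairs is at least \<open>N div 2\<close> times
  the value at that bound. This gives a positive lower bound on the \<open>L\<^sup>1\<close> distance, independent of
  \<open>N \<ge> 2\<close> (\<open>L1_distance_ge\<close>), and a lower bound on the total variation growing linearly in \<open>N\<close>
  (\<open>total_variation_ge\<close>).
\<close>

section \<open>Finite sums and integrals over sets\<close>

lemma sum_even_indices_le:
  fixes g :: "nat \<Rightarrow> 'a::ordered_comm_monoid_add"
  assumes "\<And>j. 0 \<le> g j" "2 * m \<le> n + 1"
  shows "(\<Sum>i<m. g (2 * i)) \<le> (\<Sum>j<n. g j)"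
proof -
  have "(\<Sum>i<m. g (2 * i)) = sum g ((*) 2 ` {..<m})"
    by (subst sum.reindex) (auto simp: inj_on_def)
  also have "\<dots> \<le> (\<Sum>j<n. g j)"
    using assms by (intro sum_mono2) auto
  finally show ?thesis .
qed

lemma mono_up_to:
  fixes x :: "nat \<Rightarrow> 'a::order"
  assumes "\<And>j. j < N \<Longrightarrow> x j \<le> x (Suc j)" "i \<le> j" "j \<le> N"
  shows "x i \<le> x j"
  using assms(2,3) by (induction j rule: dec_induct) (auto intro: order_trans[OF _ assms(1)])

lemma sum_gaps_le:
  fixes x :: "nat \<Rightarrow> real"
  assumes "\<And>j. j < N \<Longrightarrow> x j \<le> x (Suc j)" "2 * m \<le> N"
  shows "(\<Sum>i<m. x (2 * i + 1) - x (2 * i)) + (\<Sum>i<m. x (2 * i + 2) - x (2 * i + 1)) \<le> x N - x 0"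
    and "0 \<le> (\<Sum>i<m. x (2 * i + 1) - x (2 * i))"
    and "0 \<le> (\<Sum>i<m. x (2 * i + 2) - x (2 * i + 1))"
proof -
  have "(\<Sum>i<m. x (2 * i + 1) - x (2 * i)) + (\<Sum>i<m. x (2 * i + 2) - x (2 * i + 1)) = x (2 * m) - x 0"
    by (induction m) auto
  moreover have "x (2 * m) \<le> x N"
    by (rule mono_up_to[of N x]) (use assms in auto)
  ultimately show "(\<Sum>i<m. x (2 * i + 1) - x (2 * i)) + (\<Sum>i<m. x (2 * i + 2) - x (2 * i + 1)) \<le> x N - x 0"
    by simp
  have *: "x j \<le> x (Suc j)" if "j < 2 * m" for j using assms that by auto
  show "0 \<le> (\<Sum>i<m. x (2 * i + 1) - x (2 * i))"
    by (intro sum_nonneg) (use *[of "2 * _"] in auto)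
  show "0 \<le> (\<Sum>i<m. x (2 * i + 2) - x (2 * i + 1))"
    by (intro sum_nonneg) (use *[of "2 * _ + 1"] in auto)
qed

lemma integrable_indicator_bounded:
  fixes S :: "real set"
  assumes "S \<in> sets borel" "bounded S"
  shows "integrable lborel (indicator S :: real \<Rightarrow> real)"
  using assms emeasure_bounded_finite[of S] by (intro integrable_real_indicator) auto

lemma set_integrable_lborel:
  fixes h :: "real \<Rightarrow> real"
  assumes "integrable lborel h" "A \<in> sets borel"
  shows "set_integrable lborel A h"
  unfolding set_integrable_def
  using assms by (auto intro!: integrable_mult_indicator simp del: real_scaleR_def)

lemma set_integral_mono_set:
  fixes h :: "real \<Rightarrow> real"
  assumes "integrable lborel h" "\<And>x. 0 \<le> h x" "A \<in> sets borel" "B \<in> sets borel" "A \<subseteq> B"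
  shows "(LINT x:A|lborel. h x) \<le> (LINT x:B|lborel. h x)"
  unfolding set_lebesgue_integral_def
proof (rule integral_mono)
  show "indicator A x *\<^sub>R h x \<le> indicator B x *\<^sub>R h x" for x
    using assms(2,5) by (auto simp: indicator_def)
qed (use set_integrable_lborel assms in \<open>auto simp: set_integrable_def\<close>)

lemma set_integral_UNIV: "(LINT x:UNIV|M. h x) = (LINT x|M. h x)"
  for h :: "_ \<Rightarrow> real"
  by (simp add: set_lebesgue_integral_def)

text \<open>The primitive of an integrable function has variation at most the \<open>L\<^sup>1\<close> norm of that function.
  This turns differences of distribution functions into lower bounds for \<open>L\<^sup>1\<close> distances.\<close>

lemma increments_le_L1_norm:
  fixes h :: "real \<Rightarrow> real"
  assumes h: "integrable lborel h" and t: "\<And>j. j < n \<Longrightarrow> t j \<le> t (Suc j)"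
  shows "(\<Sum>j<n. \<bar>(LINT x:{..t (Suc j)}|lborel. h x) - (LINT x:{..t j}|lborel. h x)\<bar>)
         \<le> (LINT x|lborel. \<bar>h x\<bar>)"
proof -
  have int: "set_integrable lborel A h" "set_integrable lborel A (\<lambda>x. \<bar>h x\<bar>)"
    if "A \<in> sets borel" for A
    using that h by (auto intro!: set_integrable_lborel)
  have split: "(LINT x:{..b}|lborel. f x) = (LINT x:{..a}|lborel. f x) + (LINT x:{a<..b}|lborel. f x)"
    if "a \<le> b" "\<And>A. A \<in> sets borel \<Longrightarrow> set_integrable lborel A f" for a b and f :: "real \<Rightarrow> real"
    using that by (subst set_integral_Un[symmetric]) (auto simp: ivl_disj_un)
  have "(\<Sum>j<n. \<bar>(LINT x:{..t (Suc j)}|lborel. h x) - (LINT x:{..t j}|lborel. h x)\<bar>)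
      \<le> (\<Sum>j<n. (LINT x:{..t (Suc j)}|lborel. \<bar>h x\<bar>) - (LINT x:{..t j}|lborel. \<bar>h x\<bar>))"
  proof (intro sum_mono)
    fix j assume "j \<in> {..<n}"
    then have "t j \<le> t (Suc j)" using t by auto
    moreover have "\<bar>LINT x:{t j<..t (Suc j)}|lborel. h x\<bar> \<le> (LINT x:{t j<..t (Suc j)}|lborel. \<bar>h x\<bar>)"
      using set_integral_norm_bound[OF int(1), of "{t j<..t (Suc j)}"] by simp
    ultimately show "\<bar>(LINT x:{..t (Suc j)}|lborel. h x) - (LINT x:{..t j}|lborel. h x)\<bar>
      \<le> (LINT x:{..t (Suc j)}|lborel. \<bar>h x\<bar>) - (LINT x:{..t j}|lborel. \<bar>h x\<bar>)"
      using split[of "t j" "t (Suc j)" h] split[of "t j" "t (Suc j)" "\<lambda>x. \<bar>h x\<bar>"] int by auto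
  qed
  also have "\<dots> = (LINT x:{..t n}|lborel. \<bar>h x\<bar>) - (LINT x:{..t 0}|lborel. \<bar>h x\<bar>)"
    by (rule sum_lessThan_telescope)
  also have "\<dots> \<le> (LINT x:{..t n}|lborel. \<bar>h x\<bar>)"
    by (auto simp: set_lebesgue_integral_def)
  also have "\<dots> \<le> (LINT x:UNIV|lborel. \<bar>h x\<bar>)"
    using h by (intro set_integral_mono_set) auto
  also have "\<dots> = (LINT x|lborel. \<bar>h x\<bar>)"
    by (rule set_integral_UNIV)
  finally show ?thesis .
qed

section \<open>Weak* convergence from distribution functions\<close>

text \<open>Half-lines form an intersection-stable generator of the Borel sets, so Dynkin's argument
  propagates convergence of the distribution functions to all Borel sets. The passage to countable
  disjoint unions interchanges a limit with a series. The domination of all \<open>f n\<close> by one integrable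
  function licenses this, by Tannery's theorem.\<close>

lemma set_integral_tendsto_of_cdf:
  fixes f :: "nat \<Rightarrow> real \<Rightarrow> real"
  assumes f_int: "\<And>n. integrable lborel (f n)"
    and h_int: "integrable lborel h" and f_le: "\<And>n x. \<bar>f n x\<bar> \<le> h x"
    and g: "integrable lborel g"
    and total: "(\<lambda>n. LINT x|lborel. f n x) \<longlonglongrightarrow> (LINT x|lborel. g x)"
    and cdf: "\<And>z. (\<lambda>n. LINT x:{..z}|lborel. f n x) \<longlonglongrightarrow> (LINT x:{..z}|lborel. g x)"
    and A: "A \<in> sets borel"
  shows "(\<lambda>n. LINT x:A|lborel. f n x) \<longlonglongrightarrow> (LINT x:A|lborel. g x)"
proof -
  have 1: "Int_stable (range atMost :: real set set)"
  proof -
    have "{..x} \<inter> {..y} = {..min x y}" for x y :: real by auto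
    then show ?thesis by (auto simp: Int_stable_def)
  qed
  have eq: "sets borel = sigma_sets UNIV (range atMost :: real set set)"
    by (simp add: borel_eq_atMost)
  have 2: "range atMost \<subseteq> Pow (UNIV :: real set)" by simp
  have 3: "A \<in> sigma_sets UNIV (range atMost)" using A eq by simp
  from 1 2 3 show ?thesis
  proof (induction rule: sigma_sets_induct_disjoint)
    case (compl A)
    then have A: "A \<in> sets borel" by (simp add: eq)
    have "(LINT x:UNIV - A|lborel. k x) = (LINT x|lborel. k x) - (LINT x:A|lborel. k x)"
      if "integrable lborel k" for k :: "real \<Rightarrow> real"
    proof -
      have "(LINT x:A \<union> (UNIV - A)|lborel. k x)
          = (LINT x:A|lborel. k x) + (LINT x:UNIV - A|lborel. k x)"
        using A that by (intro set_integral_Un set_integrable_lborel) auto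
      then show ?thesis by (simp add: set_lebesgue_integral_def)
    qed
    then show ?case using compl total f_int g by (auto intro!: tendsto_diff)
  next
    case (union A)
    then have A [measurable]: "A i \<in> sets borel" for i by (auto simp: eq)
    have disj: "A i \<inter> A j = {}" if "i \<noteq> j" for i j 
      using union that by (auto simp: disjoint_family_on_def)
    have sums: "(LINT x:(\<Union>i. A i)|lborel. k x) = (\<Sum>i. LINT x:A i|lborel. k x)"
      if "integrable lborel k" for k :: "real \<Rightarrow> real"
      using disj that by (intro lebesgue_integral_countable_add set_integrable_lborel) auto
    let ?M = "\<lambda>i. LINT x:A i|lborel. h x"
    have summ: "summable ?M"
    proof -
      have nonneg: "0 \<le> h x" for x using order_trans[OF abs_ge_zero f_le] .
      show ?thesis
      proof (rule bounded_imp_summable)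
        show "0 \<le> ?M i" for i
          unfolding set_lebesgue_integral_def using nonneg by (intro Bochner_Integration.integral_nonneg) auto
        show "sum ?M {..n} \<le> (LINT x|lborel. h x)" for n
        proof -
          have "sum ?M {..n} = (LINT x:(\<Union>i\<in>{..n}. A i)|lborel. h x)"
            using disj h_int
            by (intro set_integral_finite_Union[symmetric] set_integrable_lborel) (auto simp: disjoint_family_on_def)
          also have "\<dots> \<le> (LINT x:UNIV|lborel. h x)"
            using nonneg h_int by (intro set_integral_mono_set) auto
          finally show ?thesis by (simp only: set_integral_UNIV)
        qed
      qed
    qed
    have "(\<lambda>n. \<Sum>i. LINT x:A i|lborel. f n x) \<longlonglongrightarrow> (\<Sum>i. LINT x:A i|lborel. g x)"
    proof (rule tannerys_theorem[THEN conjunct2, THEN conjunct2])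
      show "\<forall>\<^sub>F (i, n) in at_top \<times>\<^sub>F sequentially. norm (LINT x:A i|lborel. f n x) \<le> ?M i"
      proof (intro always_eventually allI, clarify)
        fix i n
        have "norm (LINT x:A i|lborel. f n x) \<le> (LINT x:A i|lborel. norm (f n x))"
          by (intro set_integral_norm_bound set_integrable_lborel f_int) auto
        also have "\<dots> \<le> ?M i"
          using f_le by (intro set_integral_mono set_integrable_lborel h_int f_int integrable_norm) auto
        finally show "norm (LINT x:A i|lborel. f n x) \<le> ?M i" .
      qed
    qed (use union.IH summ in auto)
    then show ?case using sums f_int g by simp
  qed (use cdf in \<open>auto simp: set_lebesgue_integral_def\<close>)
qed

text \<open>For densities bounded by a common constant \<open>B\<close>, the pairing with \<open>\<phi>\<close> changes by at most
  \<open>B \<parallel>\<phi> - \<psi>\<parallel>\<close> (in the \<open>L\<^sup>1\<close> norm) when \<open>\<phi>\<close> is replaced by \<open>\<psi>\<close>. Convergence on indicators of Borel sets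
  therefore extends to simple functions by linearity and then to all integrable \<open>\<phi>\<close> by approximation.\<close>

lemma weak_star_tendstoI:
  fixes f :: "nat \<Rightarrow> real \<Rightarrow> real"
  assumes f [measurable]: "\<And>n. f n \<in> borel_measurable borel"
    and f_le: "\<And>n x. \<bar>f n x\<bar> \<le> B * indicator {a..b} x"
    and g: "integrable lborel g" and g_le: "AE x in lborel. \<bar>g x\<bar> \<le> B"
    and total: "(\<lambda>n. LINT x|lborel. f n x) \<longlonglongrightarrow> (LINT x|lborel. g x)"
    and cdf: "\<And>z. (\<lambda>n. LINT x:{..z}|lborel. f n x) \<longlonglongrightarrow> (LINT x:{..z}|lborel. g x)"
  shows "weak_star_tendsto f g"
proof -
  have [measurable]: "g \<in> borel_measurable borel" using g by auto
  have "AE x::real in lborel. 0 \<le> B" by (rule eventually_mono[OF g_le]) auto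
  then have "0 \<le> B" by (simp add: eventually_const_iff ae_filter_eq_bot_iff)
  then have f_B: "\<bar>f n x\<bar> \<le> B" for n x
    using f_le[of n x] by (cases "x \<in> {a..b}") auto
  have dom: "integrable lborel (\<lambda>x. B * indicator {a..b} x :: real)"
    by (intro integrable_mult_right integrable_real_indicator) (auto simp: emeasure_lborel_Icc_eq)
  have f_int: "integrable lborel (f n)" for n
    by (rule Bochner_Integration.integrable_bound[OF dom]) (auto intro!: AE_I2 order_trans[OF f_le])
  have sets: "(\<lambda>n. LINT x:A|lborel. f n x) \<longlonglongrightarrow> (LINT x:A|lborel. g x)" if "A \<in> sets borel" for A
    using f_int dom f_le g total cdf that by (rule set_integral_tendsto_of_cdf)
  have prod_int: "integrable lborel (\<lambda>x. h x * \<psi> x)"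
    if "integrable lborel h" "AE x in lborel. \<bar>h x\<bar> \<le> B" "integrable lborel \<psi>" for h \<psi>
  proof (rule Bochner_Integration.integrable_bound)
    show "integrable lborel (\<lambda>x. B * \<psi> x)" using that by simp
    show "AE x in lborel. norm (h x * \<psi> x) \<le> norm (B * \<psi> x)"
      using that(2) by eventually_elim (auto simp: abs_mult intro!: mult_right_mono)
  qed (use that in measurable)
  have conv: "(\<lambda>n. LINT x|lborel. f n x * \<phi> x) \<longlonglongrightarrow> (LINT x|lborel. g x * \<phi> x)"
    if "integrable lborel \<phi>" for \<phi> :: "real \<Rightarrow> real"
    using that
  proof (induction rule: integrable_induct)
    case (base A c)
    then show ?case
      using tendsto_mult_right[OF sets[of A], of c]
      by (simp add: set_lebesgue_integral_def mult_ac)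
  next
    case (add \<phi> \<psi>)
    then show ?case
      using prod_int[OF f_int AE_I2[OF f_B]] prod_int[OF g g_le]
      by (simp add: distrib_left tendsto_add)
  next
    case (lim \<phi> s)
    \<comment> \<open>The approximants satisfy \<open>\<bar>s i x\<bar> \<le> 2 * \<bar>\<phi> x\<bar>\<close>, which explains the factor \<open>3\<close>.\<close>
    have D: "(\<lambda>i. LINT x|lborel. \<bar>s i x - \<phi> x\<bar>) \<longlonglongrightarrow> (LINT (x::real)|lborel. (0::real))"
    proof (rule integral_dominated_convergence[where w = "\<lambda>x. 3 * \<bar>\<phi> x\<bar>"])
      show "AE x in lborel. (\<lambda>i. \<bar>s i x - \<phi> x\<bar>) \<longlonglongrightarrow> 0"
      proof (intro AE_I2)
        fix x
        have "(\<lambda>i. s i x) \<longlonglongrightarrow> \<phi> x" using lim by simp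
        then show "(\<lambda>i. \<bar>s i x - \<phi> x\<bar>) \<longlonglongrightarrow> 0"
          by (intro tendsto_rabs_zero) (simp add: LIM_zero)
      qed
      show "AE x in lborel. norm \<bar>s i x - \<phi> x\<bar> \<le> 3 * \<bar>\<phi> x\<bar>" for i
      proof (intro AE_I2)
        fix x show "norm \<bar>s i x - \<phi> x\<bar> \<le> 3 * \<bar>\<phi> x\<bar>"
          using lim(3)[of x i] by simp
      qed
    qed (use lim in auto)
    have bound: "\<bar>(LINT x|lborel. h x * s i x) - (LINT x|lborel. h x * \<phi> x)\<bar>
        \<le> B * (LINT x|lborel. \<bar>s i x - \<phi> x\<bar>)"
      if h: "integrable lborel h" "AE x in lborel. \<bar>h x\<bar> \<le> B" for h i
    proof -
      have "(LINT x|lborel. h x * s i x) - (LINT x|lborel. h x * \<phi> x)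
          = (LINT x|lborel. h x * (s i x - \<phi> x))"
        using prod_int[OF h lim(1)] prod_int[OF h lim(4)] by (simp add: right_diff_distrib)
      also have "\<bar>\<dots>\<bar> \<le> (LINT x|lborel. B * \<bar>s i x - \<phi> x\<bar>)"
      proof -
        have "\<bar>LINT x|lborel. h x * (s i x - \<phi> x)\<bar> \<le> (LINT x|lborel. \<bar>h x * (s i x - \<phi> x)\<bar>)"
          using integral_norm_bound[of lborel "\<lambda>x. h x * (s i x - \<phi> x)"] by simp
        also have "\<dots> \<le> (LINT x|lborel. B * \<bar>s i x - \<phi> x\<bar>)"
        proof (rule integral_mono_AE)
          show "AE x in lborel. \<bar>h x * (s i x - \<phi> x)\<bar> \<le> B * \<bar>s i x - \<phi> x\<bar>"
            using h(2) by eventually_elim (auto simp: abs_mult intro: mult_right_mono)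
        qed (use lim prod_int[OF h, of "\<lambda>x. s i x - \<phi> x"] in auto)
        finally show ?thesis .
      qed
      finally show ?thesis by simp
    qed
    show ?case
    proof (rule LIMSEQ_I)
      fix e :: real assume "e > 0"
      have "(\<lambda>i. B * (LINT x|lborel. \<bar>s i x - \<phi> x\<bar>)) \<longlonglongrightarrow> 0"
        using tendsto_mult_right_zero[OF D[simplified], of B] .
      then have "\<forall>\<^sub>F i in sequentially. B * (LINT x|lborel. \<bar>s i x - \<phi> x\<bar>) < e / 3"
        using \<open>e > 0\<close> by (intro order_tendstoD) auto
      then obtain i where i: "B * (LINT x|lborel. \<bar>s i x - \<phi> x\<bar>) < e / 3"
        by (auto simp: eventually_sequentially)
      obtain n0 where n0: "\<bar>(LINT x|lborel. f n x * s i x) - (LINT x|lborel. g x * s i x)\<bar> < e / 3"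
        if "n \<ge> n0" for n
        using LIMSEQ_D[OF lim(5)[of i], of "e / 3"] \<open>e > 0\<close> by auto
      have "\<bar>(LINT x|lborel. f n x * \<phi> x) - (LINT x|lborel. g x * \<phi> x)\<bar> < e" if "n \<ge> n0" for n
        using n0[OF that] i bound[OF f_int[of n] AE_I2[OF f_B], of i] bound[OF g g_le, of i] by linarith
      then show "\<exists>n0. \<forall>n\<ge>n0. norm ((LINT x|lborel. f n x * \<phi> x) - (LINT x|lborel. g x * \<phi> x)) < e"
        by auto
    qed
  qed
  have bounded: "in_Linfty h" if "h \<in> borel_measurable lborel" "AE x in lborel. \<bar>h x\<bar> \<le> B" for h
  proof -
    have "Linfty_norm h \<le> ereal B"
      unfolding Linfty_norm_def using that by (intro esssup_I) auto
    then show ?thesis using that by (auto simp: in_Linfty_def intro: le_less_trans)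
  qed
  show ?thesis
    unfolding weak_star_tendsto_def using bounded f f_B g g_le conv by auto
qed

section \<open>Discrete densities on a strictly increasing grid\<close>

locale strict_grid =
  fixes N :: nat and y :: "nat \<Rightarrow> real"
  assumes N_pos: "1 \<le> N" and step: "\<And>j. j < N \<Longrightarrow> y j < y (Suc j)"
begin

definition cell_height :: "nat \<Rightarrow> real" where
  "cell_height j = (1 / real N) / (y (Suc j) - y j)"

lemma grid_mono: "i \<le> j \<Longrightarrow> j \<le> N \<Longrightarrow> y i \<le> y j"
  using mono_up_to[of N y] step by (meson less_imp_le)

lemma cell_unique:
  assumes "k < N" "j < N" "y k \<le> z" "z < y (Suc k)"
  shows "z \<in> {y j..<y (Suc j)} \<longleftrightarrow> j = k"
  using assms grid_mono[of "Suc j" k] grid_mono[of "Suc k" j]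
  by (cases j k rule: linorder_cases) auto

lemma eulerian_density_cell:
  assumes "k < N" "y k \<le> z" "z < y (Suc k)"
  shows "eulerian_density N y z = cell_height k"
proof -
  have "eulerian_density N y z = (\<Sum>j<N. if j = k then cell_height k else 0)"
    unfolding eulerian_density_def cell_height_def
    using cell_unique[OF assms(1) _ assms(2,3)] by (intro sum.cong) (auto simp: indicator_def)
  then show ?thesis using assms(1) by simp
qed

lemma cell_exists:
  assumes "y 0 \<le> z" "z < y N"
  obtains k where "k < N" "y k \<le> z" "z < y (Suc k)"
proof -
  define k where "k = (GREATEST k. k \<le> N \<and> y k \<le> z)"
  have k: "k \<le> N \<and> y k \<le> z"
    unfolding k_def using assms(1)
      GreatestI_nat[of "\<lambda>k. k \<le> N \<and> y k \<le> z" 0 N] by auto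
  with assms(2) have "k < N" by (metis le_neq_implies_less not_less)
  moreover have "z < y (Suc k)"
  proof (rule ccontr)
    assume "\<not> z < y (Suc k)"
    then have "Suc k \<le> N \<and> y (Suc k) \<le> z" using \<open>k < N\<close> by auto
    from Greatest_le_nat[of "\<lambda>k. k \<le> N \<and> y k \<le> z", OF this, of N]
    have "Suc k \<le> k" by (auto simp: k_def)
    then show False by simp
  qed
  ultimately show ?thesis using that k by blast
qed

lemma eulerian_density_outside:
  assumes "z \<notin> {y 0..<y N}"
  shows "eulerian_density N y z = 0"
proof -
  have "z \<notin> {y j..<y (Suc j)}" if "j < N" for j
    using assms that grid_mono[of 0 j] grid_mono[of "Suc j" N] by auto
  then show ?thesis by (auto simp: eulerian_density_def)
qed

lemma eulerian_density_measurable [measurable]: "eulerian_density N y \<in> borel_measurable borel"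
  unfolding eulerian_density_def by measurable

lemma eulerian_density_integrable: "integrable lborel (eulerian_density N y)"
  unfolding eulerian_density_def
  by (intro Bochner_Integration.integrable_sum integrable_mult_right integrable_indicator_bounded)
     auto

text \<open>Every cell carries mass \<open>1/N\<close>, whatever its length. So the distribution function is the piecewise
  linear interpolation of the values \<open>j/N\<close> at the nodes.\<close>

lemma eulerian_density_cdf:
  assumes "k < N" "y k \<le> z" "z \<le> y (Suc k)"
  shows "(LINT x:{..z}|lborel. eulerian_density N y x) = real k / real N + cell_height k * (z - y k)"
proof -
  have cell: "(LINT x|lborel. indicator ({y j..<y (Suc j)} \<inter> {..z}) x)
      = (if j < k then y (Suc j) - y j else if j = k then z - y k else 0)" (is "?L = _")
    if "j < N" for j
  proof -
    consider "j < k" | "j = k" | "k < j" by linarith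
    then show ?thesis
    proof cases
      case 1
      then have "{y j..<y (Suc j)} \<inter> {..z} = {y j..<y (Suc j)}"
        using grid_mono[of "Suc j" k] assms by auto
      then show ?thesis using 1 step[OF that] by simp
    next
      case 2
      have "?L = (LINT x|lborel. indicator {y k..z} x)"
        using assms 2 by (intro integral_discrete_difference[of "{z}"]) (auto simp: indicator_def)
      then show ?thesis using 2 assms by simp
    next
      case 3
      have "{y j..<y (Suc j)} \<inter> {..z} \<subseteq> {z}"
        using assms 3 grid_mono[of "Suc k" j] that by auto
      then have "{y j..<y (Suc j)} \<inter> {..z} = {} \<or> {y j..<y (Suc j)} \<inter> {..z} = {z}"
        by auto
      then show ?thesis using 3 by auto
    qed
  qed
  have "(LINT x:{..z}|lborel. eulerian_density N y x)
      = (LINT x|lborel. (\<Sum>j<N. cell_height j * indicator ({y j..<y (Suc j)} \<inter> {..z}) x))"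
    unfolding set_lebesgue_integral_def eulerian_density_def cell_height_def
    by (intro Bochner_Integration.integral_cong)
       (auto simp: sum_distrib_left indicator_inter_arith mult_ac)
  also have "\<dots> = (\<Sum>j<N. cell_height j * (LINT x|lborel. indicator ({y j..<y (Suc j)} \<inter> {..z}) x))"
    by (subst Bochner_Integration.integral_sum)
       (auto intro!: integrable_mult_right integrable_indicator_bounded bounded_Int)
  also have "\<dots> = (\<Sum>j<N. if j < k then 1 / real N else if j = k then cell_height k * (z - y k) else 0)"
  proof (intro sum.cong refl)
    fix j assume "j \<in> {..<N}"
    then have "j < N" by simp
    then have "cell_height j * (y (Suc j) - y j) = 1 / real N"
      using step[of j] by (simp add: cell_height_def)
    then show "cell_height j * (LINT x|lborel. indicator ({y j..<y (Suc j)} \<inter> {..z}) x)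
        = (if j < k then 1 / real N else if j = k then cell_height k * (z - y k) else 0)"
      by (subst cell[OF \<open>j < N\<close>]) auto
  qed
  also have "\<dots> = (\<Sum>j\<in>{..<k} \<union> {k}. if j < k then 1 / real N else if j = k then cell_height k * (z - y k) else 0)"
    using assms(1) by (intro sum.mono_neutral_right) auto
  also have "\<dots> = real k / real N + cell_height k * (z - y k)"
    by simp
  finally show ?thesis .
qed

lemma eulerian_density_cdf_node:
  assumes "k \<le> N"
  shows "(LINT x:{..y k}|lborel. eulerian_density N y x) = real k / real N"
proof (cases "k = N")
  case True
  with N_pos have "N - 1 < N" "Suc (N - 1) = N" by auto
  then show ?thesis
    using eulerian_density_cdf[of "N - 1" "y N"] step[of "N - 1"] True N_pos
    by (simp add: cell_height_def field_simps of_nat_diff)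
next
  case False
  then show ?thesis using eulerian_density_cdf[of k "y k"] step[of k] assms by simp
qed

lemma eulerian_density_total: "(LINT x|lborel. eulerian_density N y x) = 1"
proof -
  have "(LINT x|lborel. eulerian_density N y x) = (LINT x:{..y N}|lborel. eulerian_density N y x)"
    unfolding set_lebesgue_integral_def
    by (intro Bochner_Integration.integral_cong) (auto simp: indicator_def eulerian_density_outside)
  then show ?thesis using eulerian_density_cdf_node[of N] N_pos by simp
qed

lemma eulerian_density_nonneg: "0 \<le> eulerian_density N y z"
  unfolding eulerian_density_def using step
  by (intro sum_nonneg mult_nonneg_nonneg divide_nonneg_nonneg) (auto simp: less_imp_le)

text \<open>Two monotone functions that nearly agree at the nodes can differ in between only by an additional
  \<open>1/N\<close>, the increase of the discrete distribution function over one cell.\<close>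

lemma eulerian_density_cdf_close:
  assumes mono: "\<And>u v. u \<le> v \<Longrightarrow> F u \<le> F v" and range: "\<And>u. 0 \<le> F u" "\<And>u. F u \<le> 1"
    and close: "\<And>j. j \<le> N \<Longrightarrow> \<bar>F (y j) - real j / real N\<bar> \<le> d"
  shows "\<bar>(LINT x:{..z}|lborel. eulerian_density N y x) - F z\<bar> \<le> 1 / real N + d"
proof -
  let ?E = "\<lambda>z. LINT x:{..z}|lborel. eulerian_density N y x"
  have E_mono: "?E u \<le> ?E v" if "u \<le> v" for u v
    using that eulerian_density_nonneg eulerian_density_integrable
    by (intro set_integral_mono_set) auto
  have E_range: "0 \<le> ?E u" "?E u \<le> 1" for u
  proof -
    show "0 \<le> ?E u" 
      using eulerian_density_nonneg by (auto simp: set_lebesgue_integral_def)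
    have "?E u \<le> (LINT x:UNIV|lborel. eulerian_density N y x)"
      using eulerian_density_nonneg eulerian_density_integrable
      by (intro set_integral_mono_set) auto
    then show "?E u \<le> 1" by (simp add: set_integral_UNIV eulerian_density_total)
  qed
  have "0 < 1 / real N" using N_pos by simp
  consider "z < y 0" | "y N \<le> z" | "y 0 \<le> z" "z < y N" by linarith
  then show ?thesis
  proof cases
    case 1
    then have "?E z \<le> 0" "F z \<le> d"
      using E_mono[of z "y 0"] mono[of z "y 0"] eulerian_density_cdf_node[of 0] close[of 0] by auto
    then show ?thesis using E_range[of z] range[of z] \<open>0 < 1 / real N\<close> by linarith
  next
    case 2
    then have "?E z \<ge> 1" "F z \<ge> 1 - d"
      using E_mono[of "y N" z] mono[of "y N" z] eulerian_density_cdf_node[of N] close[of N] N_pos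
      by auto
    then show ?thesis using E_range[of z] range[of z] \<open>0 < 1 / real N\<close> by linarith
  next
    case 3
    then obtain k where k: "k < N" "y k \<le> z" "z < y (Suc k)" by (rule cell_exists)
    then have "?E z \<in> {real k / real N..real (Suc k) / real N}"
      using E_mono[of "y k" z] E_mono[of z "y (Suc k)"]
        eulerian_density_cdf_node[of k] eulerian_density_cdf_node[of "Suc k"] by auto
    moreover have "F z \<in> {real k / real N - d..real (Suc k) / real N + d}"
      using mono[of "y k" z] mono[of z "y (Suc k)"] close[of k] close[of "Suc k"] k by auto
    moreover have "real (Suc k) / real N = real k / real N + 1 / real N"
      by (simp add: add_divide_distrib)
    ultimately show ?thesis by auto
  qed
qed

text \<open>The nodes themselves serve as partition; every cell contains its left endpoint, so all cell heights are
  among the values at the nodes.\<close>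

lemma sum_jumps_le_total_variation:
  "ennreal (\<Sum>j<N. \<bar>eulerian_density N y (y (Suc j)) - eulerian_density N y (y j)\<bar>)
    \<le> total_variation (eulerian_density N y)"
proof -
  let ?f = "eulerian_density N y" and ?t = "\<lambda>j. y (min j N)"
  have "mono ?t" by (auto intro!: monoI grid_mono)
  have "ennreal (\<Sum>j<N. \<bar>?f (y (Suc j)) - ?f (y j)\<bar>)
      = (\<Sum>j<N. ennreal \<bar>?f (?t (Suc j)) - ?f (?t j)\<bar>)"
    by (subst sum_ennreal[symmetric]) (auto intro!: sum.cong)
  also have "\<dots> \<le> total_variation ?f"
    unfolding total_variation_def using \<open>mono ?t\<close>
    by (intro SUP_upper2[of "(N, ?t)"]) auto
  finally show ?thesis .
qed

end

section \<open>Convexity bounds for sums of reciprocals\<close>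

text \<open>For \<open>s > 0\<close> the left-hand side is the line tangent to the convex function \<open>1/u\<close> at \<open>u = 1/s\<close>.\<close>

lemma inverse_tangent:
  fixes s u :: real
  assumes "0 < u"
  shows "2 * s - s\<^sup>2 * u \<le> 1 / u"
proof -
  have "0 \<le> (1 - s * u)\<^sup>2" by simp
  then have "(2 * s - s\<^sup>2 * u) * u \<le> 1" by (simp add: power2_eq_square algebra_simps)
  then show ?thesis using assms by (simp add: pos_le_divide_eq)
qed

text \<open>Likewise for \<open>1/u\<^sup>2\<close>: the difference, multiplied by \<open>u\<^sup>2\<close>, factors as \<open>(1 - s u)\<^sup>2 (1 + 2 s u)\<close>.\<close>

lemma inverse_square_tangent:
  fixes s u :: real
  assumes "0 < u" "0 \<le> s"
  shows "3 * s\<^sup>2 - 2 * s ^ 3 * u \<le> 1 / u\<^sup>2"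
proof -
  have "0 \<le> (1 - s * u)\<^sup>2 * (1 + 2 * (s * u))" using assms by simp
  then have "(3 * s\<^sup>2 - 2 * s ^ 3 * u) * u\<^sup>2 \<le> 1"
    by (simp add: power2_eq_square power3_eq_cube algebra_simps)
  then show ?thesis using assms by (simp add: pos_le_divide_eq)
qed

text \<open>Jensen's inequality in the form used below, where only an upper bound \<open>K\<close> on the mean of the \<open>u i\<close>
  is known. Summing the tangent lines at \<open>K\<close> suffices, since their slope is negative.\<close>

lemma sum_inverse_ge:
  fixes u :: "nat \<Rightarrow> real"
  assumes "\<And>i. i < m \<Longrightarrow> 0 < u i" "(\<Sum>i<m. u i) \<le> real m * K" "0 < K"
  shows "real m / K \<le> (\<Sum>i<m. 1 / u i)"
proof -
  have "real m / K = real m * (2 * (1 / K)) - (1 / K)\<^sup>2 * (real m * K)"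
    using assms(3) by (simp add: power2_eq_square)
  also have "\<dots> \<le> real m * (2 * (1 / K)) - (1 / K)\<^sup>2 * (\<Sum>i<m. u i)"
    using assms(2) by (intro diff_left_mono mult_left_mono) auto
  also have "\<dots> = (\<Sum>i<m. 2 * (1 / K) - (1 / K)\<^sup>2 * u i)"
    by (simp add: sum_subtractf sum_distrib_left)
  also have "\<dots> \<le> (\<Sum>i<m. 1 / u i)"
    using assms(1) by (intro sum_mono inverse_tangent) auto
  finally show ?thesis .
qed

lemma sum_inverse_square_ge:
  fixes u :: "nat \<Rightarrow> real"
  assumes "\<And>i. i < m \<Longrightarrow> 0 < u i" "(\<Sum>i<m. u i) \<le> real m * K" "0 < K"
  shows "real m / K\<^sup>2 \<le> (\<Sum>i<m. 1 / (u i)\<^sup>2)"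
proof -
  have "real m / K\<^sup>2 = real m * (3 * (1 / K)\<^sup>2) - 2 * (1 / K) ^ 3 * (real m * K)"
    using assms(3) by (simp add: power2_eq_square power3_eq_cube field_simps)
  also have "\<dots> \<le> real m * (3 * (1 / K)\<^sup>2) - 2 * (1 / K) ^ 3 * (\<Sum>i<m. u i)"
    using assms(2,3) by (intro diff_left_mono mult_left_mono) auto
  also have "\<dots> = (\<Sum>i<m. 3 * (1 / K)\<^sup>2 - 2 * (1 / K) ^ 3 * u i)"
    by (simp add: sum_subtractf sum_distrib_left)
  also have "\<dots> \<le> (\<Sum>i<m. 1 / (u i)\<^sup>2)"
    using assms(1,3) by (intro sum_mono inverse_square_tangent) auto
  finally show ?thesis .
qed

section \<open>Oscillation on grids with the midpoint modification\<close>

text \<open>The gap condition is the trace on the grid of the density bound \<open>1/2\<close>: an interval of mass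
  \<open>1/N\<close> has length at least \<open>2/N\<close>.\<close>

locale coarse_grid =
  fixes N :: nat and x :: "nat \<Rightarrow> real"
  assumes N_pos: "1 \<le> N" and gap: "\<And>j. j < N \<Longrightarrow> 2 / real N \<le> x (Suc j) - x j"
begin

abbreviation y :: "nat \<Rightarrow> real" where "y \<equiv> modified_pos x N"

abbreviation f :: "real \<Rightarrow> real" where "f \<equiv> eulerian_density N y"

lemma y_even [simp]: "even j \<Longrightarrow> y j = x j"
  and y_last [simp]: "y N = x N"
  and y_odd: "odd j \<Longrightarrow> j \<noteq> N \<Longrightarrow> y j = (x (j - 1) + x j) / 2"
  by (auto simp: modified_pos_def)

lemma y_gap:
  assumes "j < N"
  shows "1 / real N \<le> y (Suc j) - y j"
proof (cases "even j")
  case True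
  then show ?thesis
    using gap[OF assms] N_pos by (cases "Suc j = N") (auto simp: y_odd field_simps)
next
  case False
  then obtain i where j: "j = Suc i" by (cases j) auto
  have "0 < 1 / real N" using N_pos by simp
  with False show ?thesis
    using gap[OF assms] gap[of i] assms by (simp add: j y_odd field_simps)
qed

end

sublocale coarse_grid \<subseteq> strict_grid N "modified_pos x N"
proof
  fix j assume "j < N"
  from y_gap[OF this] N_pos show "y j < y (Suc j)"
    by (smt (verit) divide_pos_pos of_nat_0_less_iff less_le_trans zero_less_one)
qed (rule N_pos)

context coarse_grid
begin

text \<open>Halving a gap of length at least \<open>2/N\<close> leaves a cell of length at least \<open>1/N\<close>, which is just enough
  for its mass \<open>1/N\<close>.\<close>

lemma density_le_1: "f z \<le> 1"
proof (cases "z \<in> {y 0..<y N}")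
  case True
  then obtain k where k: "k < N" "y k \<le> z" "z < y (Suc k)" using cell_exists by auto
  have "cell_height k \<le> 1"
    unfolding cell_height_def using y_gap[OF k(1)] step[OF k(1)] by (subst divide_le_eq_1_pos) auto
  then show ?thesis using eulerian_density_cell[OF k] by simp
qed (simp add: eulerian_density_outside)

lemma cell_height_even:
  assumes "2 * i + 2 \<le> N"
  shows "cell_height (2 * i) = 2 / (real N * (x (2 * i + 1) - x (2 * i)))"
  using assms gap[of "2 * i"] N_pos by (simp add: cell_height_def y_odd field_simps)

lemma cell_height_odd:
  assumes "2 * i + 2 \<le> N"
  shows "cell_height (2 * i + 1) = 2 / (2 * (real N * (x (2 * i + 2) - x (2 * i + 1)))
           + real N * (x (2 * i + 1) - x (2 * i)))"
proof -
  have "y (Suc (2 * i + 1)) - y (2 * i + 1)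
      = (2 * (x (2 * i + 2) - x (2 * i + 1)) + (x (2 * i + 1) - x (2 * i))) / 2"
    using assms by (simp add: y_odd field_simps)
  moreover have "1 / n / ((2 * a + b) / 2) = 2 / (2 * (n * a) + n * b)" for n a b :: real
    by (simp add: distrib_left mult.left_commute)
  ultimately show ?thesis
    unfolding cell_height_def by (simp only:)
qed

lemma x_step:
  assumes "j < N"
  shows "x j < x (Suc j)"
proof -
  have "0 < 2 / real N" using N_pos by simp
  then show ?thesis using gap[OF assms] by linarith
qed

lemma scaled_gap:
  assumes "j < N"
  shows "2 \<le> real N * (x (Suc j) - x j)"
  using gap[OF assms] N_pos by (simp add: field_simps)

text \<open>With \<open>t\<close> and \<open>t'\<close> the two gaps scaled by \<open>N\<close>, the jump is \<open>2/t - 2/(t + 2t')\<close>. It is smallest for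
  \<open>t' = 2\<close>, and there equals \<open>8/(t (t + 4)) = 8/((t + 2)\<^sup>2 - 4)\<close>.\<close>

lemma jump_ge:
  assumes "2 * i + 2 \<le> N"
  shows "8 / (real N * (x (2 * i + 1) - x (2 * i)) + 2)\<^sup>2 \<le> \<bar>f (y (Suc (2 * i))) - f (y (2 * i))\<bar>"
proof -
  define t where "t = real N * (x (2 * i + 1) - x (2 * i))"
  define t' where "t' = real N * (x (2 * i + 2) - x (2 * i + 1))"
  have t: "2 \<le> t" "2 \<le> t'"
    using scaled_gap[of "2 * i"] scaled_gap[of "2 * i + 1"] assms by (auto simp: t_def t'_def)
  have "f (y (2 * i)) = 2 / t" "f (y (Suc (2 * i))) = 2 / (2 * t' + t)"
    using assms step[of "2 * i"] step[of "2 * i + 1"]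
      eulerian_density_cell[of "2 * i" "y (2 * i)"]
      eulerian_density_cell[of "2 * i + 1" "y (2 * i + 1)"]
      cell_height_even[OF assms] cell_height_odd[OF assms]
    by (simp_all add: t_def t'_def)
  moreover have "2 / (2 * t' + t) \<le> 2 / (t + 4)" using t by (intro divide_left_mono) auto
  moreover have "8 / (t + 2)\<^sup>2 \<le> 2 / t - 2 / (t + 4)"
  proof -
    have "8 / (t + 2)\<^sup>2 \<le> 8 / (t * (t + 4))"
    proof (rule divide_left_mono)
      show "t * (t + 4) \<le> (t + 2)\<^sup>2" by (simp add: power2_eq_square algebra_simps)
    qed (use t in \<open>auto intro!: mult_pos_pos\<close>)
    also have "\<dots> = 2 / t - 2 / (t + 4)" using t by (simp add: field_simps)
    finally show ?thesis .
  qed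
  ultimately show ?thesis by (simp add: t_def)
qed

text \<open>The factor \<open>3\<close> comes from \<open>N \<le> 3 (N div 2)\<close>, which holds for \<open>N \<ge> 2\<close> with equality at \<open>N = 3\<close>.\<close>

lemma pair_sums:
  assumes "2 \<le> N" "x N - x 0 \<le> L"
  shows "(\<Sum>i<N div 2. real N * (x (2 * i + 1) - x (2 * i))) \<le> real (N div 2) * (3 * L)"
    and "(\<Sum>i<N div 2. real N * (x (2 * i + 2) - x (2 * i + 1))) \<le> real (N div 2) * (3 * L)"
proof -
  have mono: "x j \<le> x (Suc j)" if "j < N" for j
    using x_step[OF that] by simp
  note gaps = sum_gaps_le[of N x "N div 2", OF mono]
  have "N \<le> 3 * (N div 2)" using assms(1) by linarith
  then have N3: "real N \<le> 3 * real (N div 2)" by linarith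
  have bound: "real N * G \<le> real (N div 2) * (3 * L)" if "0 \<le> G" "G \<le> L" for G
  proof -
    have "real N * G \<le> (3 * real (N div 2)) * L"
      using that N3 by (intro mult_mono) auto
    then show ?thesis by (simp add: mult_ac)
  qed
  show "(\<Sum>i<N div 2. real N * (x (2 * i + 1) - x (2 * i))) \<le> real (N div 2) * (3 * L)"
    unfolding sum_distrib_left[symmetric] using gaps assms(2) by (intro bound) auto
  show "(\<Sum>i<N div 2. real N * (x (2 * i + 2) - x (2 * i + 1))) \<le> real (N div 2) * (3 * L)"
    unfolding sum_distrib_left[symmetric] using gaps assms(2) by (intro bound) auto
qed

lemma length_nonneg: "0 \<le> x N - x 0"
  using grid_mono[of 0 N] by simp

lemma total_variation_ge:
  assumes "2 \<le> N" "x N - x 0 \<le> L"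
  shows "ennreal (8 * (real (N div 2) / (3 * L + 2)\<^sup>2)) \<le> total_variation f"
proof -
  let ?u = "\<lambda>i. real N * (x (2 * i + 1) - x (2 * i)) + 2"
  have "real (N div 2) / (3 * L + 2)\<^sup>2 \<le> (\<Sum>i<N div 2. 1 / (?u i)\<^sup>2)"
  proof (rule sum_inverse_square_ge)
    show "0 < ?u i" if "i < N div 2" for i
    proof -
      have "2 * i < N" using that by linarith
      then show ?thesis using scaled_gap[of "2 * i"] by simp
    qed
    show "(\<Sum>i<N div 2. ?u i) \<le> real (N div 2) * (3 * L + 2)"
      using pair_sums(1)[OF assms] by (simp add: sum.distrib distrib_left)
    show "0 < 3 * L + 2" using length_nonneg assms(2) by simp
  qed
  then have "8 * (real (N div 2) / (3 * L + 2)\<^sup>2) \<le> (\<Sum>i<N div 2. 8 / (?u i)\<^sup>2)"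
    by (simp add: sum_distrib_left[symmetric, of 8 "\<lambda>i. 1 / (?u i)\<^sup>2", simplified])
  also have "\<dots> \<le> (\<Sum>i<N div 2. \<bar>f (y (Suc (2 * i))) - f (y (2 * i))\<bar>)"
    by (intro sum_mono jump_ge) auto
  also have "\<dots> \<le> (\<Sum>j<N. \<bar>f (y (Suc j)) - f (y j)\<bar>)"
    using sum_even_indices_le[of "\<lambda>j. \<bar>f (y (Suc j)) - f (y j)\<bar>" "N div 2" N] by simp
  finally show ?thesis
    using sum_jumps_le_total_variation by (meson ennreal_leI order_trans)
qed

text \<open>At the even node \<open>x (2 * i)\<close> the discrete distribution function is exact. The mass of the cell
  starting at the midpoint is spread over the second gap and half of the first, so the part of it in
  the first gap is in excess at \<open>x (2 * i + 1)\<close>. A longer first gap gets a larger share, so its minimal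
  scaled length \<open>2\<close> is the worst case.\<close>

lemma excess_ge:
  assumes "2 * i + 2 \<le> N"
  shows "(1 / real N) * (1 / (real N * (x (2 * i + 2) - x (2 * i + 1)) + 1))
    \<le> (LINT z:{..x (2 * i + 1)}|lborel. f z) - real (2 * i + 1) / real N"
proof -
  define t where "t = real N * (x (2 * i + 1) - x (2 * i))"
  define t' where "t' = real N * (x (2 * i + 2) - x (2 * i + 1))"
  have t: "2 \<le> t" "2 \<le> t'"
    using scaled_gap[of "2 * i"] scaled_gap[of "2 * i + 1"] assms by (auto simp: t_def t'_def)
  have "x (2 * i) < x (2 * i + 1)" "x (2 * i + 1) < x (2 * i + 2)"
    using x_step[of "2 * i"] x_step[of "2 * i + 1"] assms by auto
  then have "(LINT z:{..x (2 * i + 1)}|lborel. f z) - real (2 * i + 1) / real N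
      = cell_height (2 * i + 1) * (x (2 * i + 1) - y (2 * i + 1))"
    using assms by (subst eulerian_density_cdf[of "2 * i + 1"]) (auto simp: y_odd)
  also have "x (2 * i + 1) - y (2 * i + 1) = t / real N / 2"
    using assms N_pos by (simp add: y_odd t_def field_simps)
  also have "cell_height (2 * i + 1) = 2 / (2 * t' + t)"
    using cell_height_odd[OF assms] by (simp add: t_def t'_def)
  also have "2 / (2 * t' + t) * (t / real N / 2) = (1 / real N) * (t / (2 * t' + t))"
    by simp
  finally have "(LINT z:{..x (2 * i + 1)}|lborel. f z) - real (2 * i + 1) / real N
      = (1 / real N) * (t / (2 * t' + t))" .
  moreover have "(1 / real N) * (1 / (t' + 1)) \<le> (1 / real N) * (t / (2 * t' + t))"
  proof (rule mult_left_mono)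
    show "1 / (t' + 1) \<le> t / (2 * t' + t)"
      using t by (simp add: divide_simps) (simp add: algebra_simps)
  qed simp
  ultimately show ?thesis
    unfolding t'_def[symmetric] by (simp only:)
qed

text \<open>Since \<open>g\<close> has mass \<open>1/N\<close> on every gap, the increment of the primitive \<open>H\<close> of \<open>f - g\<close> over the first
  gap of a pair is precisely the excess mass. The convexity bound sums up the contributions of the
  pairs.\<close>

lemma L1_distance_ge:
  assumes "2 \<le> N" "x N - x 0 \<le> L"
    and g: "integrable lborel g" "\<And>j. j \<le> N \<Longrightarrow> (LINT z:{..x j}|lborel. g z) = real j / real N"
  shows "1 / (3 * (3 * L + 1)) \<le> (LINT z|lborel. \<bar>f z - g z\<bar>)"
proof -
  define H where "H c = (LINT z:{..c}|lborel. f z - g z)" for c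
  have H: "H c = (LINT z:{..c}|lborel. f z) - (LINT z:{..c}|lborel. g z)" for c
    unfolding H_def using g eulerian_density_integrable
    by (intro set_integral_diff set_integrable_lborel) auto
  have even: "H (x (2 * i)) = 0" if "2 * i \<le> N" for i
    using eulerian_density_cdf_node[of "2 * i"] g(2)[of "2 * i"] that by (simp add: H)
  let ?u = "\<lambda>i. real N * (x (2 * i + 2) - x (2 * i + 1)) + 1"
  have "real (N div 2) / (3 * L + 1) \<le> (\<Sum>i<N div 2. 1 / ?u i)"
  proof (rule sum_inverse_ge)
    show "0 < ?u i" if "i < N div 2" for i
    proof -
      have "2 * i + 1 < N" using that by linarith
      then show ?thesis using scaled_gap[of "2 * i + 1"] by simp
    qed
    show "(\<Sum>i<N div 2. ?u i) \<le> real (N div 2) * (3 * L + 1)"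
      using pair_sums(2)[OF assms(1,2)] by (simp add: sum.distrib distrib_left)
    show "0 < 3 * L + 1" using length_nonneg assms(2) by simp
  qed
  have "N \<le> 3 * (N div 2)" using assms(1) by linarith
  then have "1 / 3 \<le> (1 / real N) * real (N div 2)" using N_pos by (simp add: field_simps)
  then have "1 / 3 * (1 / (3 * L + 1)) \<le> (1 / real N) * real (N div 2) * (1 / (3 * L + 1))"
    using length_nonneg assms(2) by (intro mult_right_mono) auto
  then have "1 / (3 * (3 * L + 1)) \<le> (1 / real N) * (real (N div 2) / (3 * L + 1))"
    by simp
  also have "\<dots> \<le> (1 / real N) * (\<Sum>i<N div 2. 1 / ?u i)"
    by (intro mult_left_mono) (fact, simp)
  also have "\<dots> = (\<Sum>i<N div 2. (1 / real N) * (1 / ?u i))"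
    by (rule sum_distrib_left)
  also have "\<dots> \<le> (\<Sum>i<N div 2. \<bar>H (x (Suc (2 * i))) - H (x (2 * i))\<bar>)"
  proof (rule sum_mono)
    fix i assume "i \<in> {..<N div 2}"
    then have i: "2 * i + 2 \<le> N" by auto
    then show "(1 / real N) * (1 / ?u i) \<le> \<bar>H (x (Suc (2 * i))) - H (x (2 * i))\<bar>"
      using excess_ge[OF i] g(2)[of "2 * i + 1"] even[of i] by (simp add: H)
  qed
  also have "\<dots> \<le> (\<Sum>j<N. \<bar>H (x (Suc j)) - H (x j)\<bar>)"
    using sum_even_indices_le[of "\<lambda>j. \<bar>H (x (Suc j)) - H (x j)\<bar>" "N div 2" N] by simp
  also have "\<dots> \<le> (LINT z|lborel. \<bar>f z - g z\<bar>)"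
    unfolding H_def
  proof (rule increments_le_L1_norm)
    show "x j \<le> x (Suc j)" if "j < N" for j
      using x_step[OF that] by simp
  qed (use g eulerian_density_integrable in auto)
  finally show ?thesis .
qed

end

section \<open>Quantiles of a measure with density at most one half\<close>

locale half_bounded_density =
  fixes \<mu> :: "real measure" and \<rho> :: "real \<Rightarrow> real"
  assumes prob_compact: "\<mu> \<in> prob_compact_support"
    and density: "is_density \<mu> \<rho>"
    and half: "Linfty_norm \<rho> \<le> ereal (1 / 2)"

sublocale half_bounded_density \<subseteq> real_distribution \<mu>
  using prob_compact
  by (auto simp: prob_compact_support_def real_distribution_def real_distribution_axioms_def)

context half_bounded_density
begin

lemma rho_measurable [measurable]: "\<rho> \<in> borel_measurable borel"
  using density by (auto simp: is_density_def)

lemma mu_eq_density: "\<mu> = density lborel (\<lambda>x. ennreal (\<rho> x))"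
  using density by (auto simp: is_density_def)

lemma rho_nonneg: "AE x in lborel. 0 \<le> \<rho> x"
  using density by (auto simp: is_density_def)

lemma rho_le_half: "AE x in lborel. \<rho> x \<le> 1 / 2"
proof -
  have "AE x in lborel. ereal \<bar>\<rho> x\<bar> \<le> Linfty_norm \<rho>"
    unfolding Linfty_norm_def by (rule esssup_AE)
  then show ?thesis
  proof eventually_elim
    case (elim x)
    then have "ereal \<bar>\<rho> x\<bar> \<le> ereal (1 / 2)" using half by (rule order_trans)
    then show ?case by simp
  qed
qed

lemma rho_integrable: "integrable lborel \<rho>"
proof (rule integrableI_nonneg)
  have "emeasure \<mu> UNIV = (\<integral>\<^sup>+ x. ennreal (\<rho> x) \<partial>lborel)"
    by (subst mu_eq_density, subst emeasure_density) auto
  moreover have "emeasure \<mu> UNIV = 1" using emeasure_space_1 by (simp add: borel_UNIV)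
  ultimately show "(\<integral>\<^sup>+ x. ennreal (\<rho> x) \<partial>lborel) < \<infinity>" by simp
qed (use rho_nonneg in auto)

lemma set_integral_rho: "A \<in> sets borel \<Longrightarrow> (LINT x:A|lborel. \<rho> x) = measure \<mu> A"
proof -
  assume A: "A \<in> sets borel"
  have "measure \<mu> A = (LINT x|\<mu>. indicator A x)" using A by (simp add: borel_UNIV)
  also have "\<dots> = (LINT x:A|lborel. \<rho> x)"
    unfolding set_lebesgue_integral_def using A rho_nonneg
    by (subst mu_eq_density, subst integral_density) (auto simp: mult.commute)
  finally show ?thesis by simp
qed

lemma set_integral_rho_atMost: "(LINT x:{..z}|lborel. \<rho> x) = cdf \<mu> z"
  by (simp add: set_integral_rho cdf_def)

lemma integral_rho: "(LINT x|lborel. \<rho> x) = 1"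
  using set_integral_rho[of UNIV] prob_space by (simp add: set_integral_UNIV borel_UNIV)

lemma cdf_increment:
  assumes "u \<le> v"
  shows "cdf \<mu> v - cdf \<mu> u = measure \<mu> {u<..v}"
  using assms cdf_diff_eq[of u v] by (cases "u = v") auto

lemma cdf_increment_le:
  assumes "u \<le> v"
  shows "cdf \<mu> v - cdf \<mu> u \<le> (v - u) / 2"
proof -
  have "cdf \<mu> v - cdf \<mu> u = (LINT x:{u<..v}|lborel. \<rho> x)"
    using cdf_increment[OF assms] by (simp add: set_integral_rho)
  also have "\<dots> \<le> (LINT x:{u<..v}|lborel. 1 / 2)"
  proof (rule set_integral_mono_AE)
    show "set_integrable lborel {u<..v} \<rho>"
      using rho_integrable by (intro set_integrable_lborel) auto
    show "set_integrable lborel {u<..v} (\<lambda>x. 1 / 2 :: real)"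
      unfolding set_integrable_def by (auto intro!: integrable_divide integrable_indicator_bounded)
  qed (use rho_le_half in auto)
  also have "\<dots> = (v - u) / 2"
    using assms by (simp add: set_lebesgue_integral_def)
  finally show ?thesis .
qed

lemma interval_integral_rho: "(LBINT y=ereal u..ereal v. \<rho> y) = cdf \<mu> v - cdf \<mu> u"
proof -
  have *: "(LBINT y=ereal u..ereal v. \<rho> y) = cdf \<mu> v - cdf \<mu> u" if "u \<le> v" for u v
    using that by (simp add: interval_integral_Ioc set_integral_rho cdf_increment)
  show ?thesis
  proof (cases "u \<le> v")
    case False
    then show ?thesis using *[of v u] by (subst interval_integral_endpoints_reverse) auto
  qed (rule *)
qed

text \<open>The complement of the support is the union of all open null sets. This union may be uncountable;
  Lindeloef's theorem reduces it to a countable one.\<close>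

lemma measure_outside_support: "measure \<mu> (- measure_support \<mu>) = 0"
proof -
  define \<U> where "\<U> = {U. open U \<and> emeasure \<mu> U = 0}"
  have "- measure_support \<mu> = \<Union>\<U>"
    by (auto simp: measure_support_def \<U>_def not_gr_zero)
  moreover obtain \<V> where \<V>: "\<V> \<subseteq> \<U>" "countable \<V>" "\<Union>\<V> = \<Union>\<U>"
    by (rule Lindelof[of \<U>]) (auto simp: \<U>_def)
  moreover have "\<Union>\<V> \<in> null_sets \<mu>"
    using \<V> by (intro null_sets_UN'[of \<V> "\<lambda>x. x", simplified]) (auto simp: \<U>_def null_sets_def)
  ultimately show ?thesis by (auto simp: measure_eq_0_null_sets)
qed

lemma support_compact: "compact (measure_support \<mu>)"
  using prob_compact by (simp add: prob_compact_support_def)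

lemma support_nonempty: "measure_support \<mu> \<noteq> {}"
  using measure_outside_support prob_space by (auto simp: borel_UNIV)

lemma measure_disjoint_support:
  assumes "A \<in> sets borel" "A \<inter> measure_support \<mu> = {}"
  shows "measure \<mu> A = 0"
proof -
  have "measure \<mu> A \<le> measure \<mu> (- measure_support \<mu>)"
    using assms support_compact
    by (intro finite_measure_mono) (auto dest: compact_imp_closed)
  then show ?thesis using measure_outside_support measure_nonneg[of \<mu> A] by simp
qed

lemma support_bounds:
  assumes "x \<in> measure_support \<mu>"
  shows "Inf (measure_support \<mu>) \<le> x" "x \<le> Sup (measure_support \<mu>)"
  using assms support_compact[THEN compact_imp_bounded]
  by (auto intro!: cInf_lower cSup_upper bounded_imp_bdd_above bounded_imp_bdd_below)

text \<open>Strictly left of the infimum there is no mass, and the Lipschitz bound excludes a jump at it.\<close>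

lemma cdf_Inf_support: "cdf \<mu> (Inf (measure_support \<mu>)) = 0"
proof -
  let ?a = "Inf (measure_support \<mu>)"
  have "cdf \<mu> (?a - e) = 0" if "e > 0" for e
    unfolding cdf_def using support_bounds(1) that
    by (intro measure_disjoint_support) force+
  then have le: "cdf \<mu> ?a \<le> e / 2" if "e > 0" for e
    using cdf_increment_le[of "?a - e" ?a] that by simp
  have "cdf \<mu> ?a \<le> 0"
  proof (rule field_le_epsilon)
    fix e :: real assume "0 < e"
    then show "cdf \<mu> ?a \<le> 0 + e" using le[of e] by simp
  qed
  then show ?thesis using cdf_nonneg[of ?a] by simp
qed

lemma cdf_Sup_support: "cdf \<mu> (Sup (measure_support \<mu>)) = 1"
proof -
  let ?b = "Sup (measure_support \<mu>)"
  have "measure \<mu> {?b<..} = 0"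
    using support_bounds(2) by (intro measure_disjoint_support) force+
  moreover have "measure \<mu> {..?b} = 1 - measure \<mu> {?b<..}"
    using prob_compl[of "{?b<..}"] by (simp add: borel_UNIV Compl_eq_Diff_UNIV[symmetric] Compl_greaterThan)
  ultimately show ?thesis by (simp add: cdf_def)
qed

text \<open>Lipschitz continuity is used quantitatively: a defect or an excess of \<open>d\<close> at the supremum would
  persist within distance \<open>d\<close> of it, since \<open>F\<close> changes there by at most \<open>d/2\<close>.\<close>

lemma cdf_Sup_sublevel:
  assumes "0 < c" "c \<le> 1"
  shows "cdf \<mu> (Sup {x. cdf \<mu> x < c}) = c" "Sup {x. cdf \<mu> x < c} \<le> Sup (measure_support \<mu>)"
proof -
  let ?S = "{x. cdf \<mu> x < c}" and ?b = "Sup (measure_support \<mu>)"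
  define z where "z = Sup ?S"
  have ub: "x \<le> ?b" if "x \<in> ?S" for x
    using that cdf_nondecreasing[of ?b x] cdf_Sup_support assms by force
  have "Inf (measure_support \<mu>) \<in> ?S" using cdf_Inf_support assms by simp
  then have ne: "?S \<noteq> {}" by blast
  have bdd: "bdd_above ?S" using ub by (rule bdd_aboveI)
  show "Sup ?S \<le> ?b" using ne ub by (rule cSup_least)
  have "cdf \<mu> z \<le> c"
  proof (rule ccontr)
    assume "\<not> cdf \<mu> z \<le> c"
    then have "z - (cdf \<mu> z - c) < Sup ?S" by (simp add: z_def)
    then obtain x where x: "x \<in> ?S" "z - (cdf \<mu> z - c) < x"
      using less_cSupD[OF ne] by blast
    have "x \<le> z" unfolding z_def using x(1) bdd by (rule cSup_upper)
    with x cdf_increment_le[of x z] \<open>\<not> cdf \<mu> z \<le> c\<close> show False by auto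
  qed
  moreover have "c \<le> cdf \<mu> z"
  proof (rule ccontr)
    assume less: "\<not> c \<le> cdf \<mu> z"
    let ?x = "z + (c - cdf \<mu> z)"
    have "?x \<in> ?S" using cdf_increment_le[of z ?x] less by auto
    then have "?x \<le> z" unfolding z_def using bdd by (rule cSup_upper)
    then show False using less by simp
  qed
  ultimately show "cdf \<mu> (Sup ?S) = c" by (simp add: z_def)
qed

text \<open>Since \<open>F\<close> is exact at every node, the recursion does not accumulate errors: the next node is
  the supremum of the sublevel set of \<open>F\<close> at \<open>(j + 1)/N\<close>, regardless of the previous one. Nodes never
  leave the convex hull of the support.\<close>

lemma cdf_quantile_pos:
  assumes "1 \<le> N" "j \<le> N"
  shows "cdf \<mu> (quantile_pos \<mu> \<rho> N j) = real j / real N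
    \<and> quantile_pos \<mu> \<rho> N j \<le> Sup (measure_support \<mu>)"
  using assms(2)
proof (induction j)
  case 0
  then show ?case using cdf_Inf_support support_bounds support_nonempty by fastforce
next
  case (Suc j)
  have "quantile_pos \<mu> \<rho> N (Suc j) = Sup {x. cdf \<mu> x < real (Suc j) / real N}"
    using Suc by (simp add: interval_integral_rho add_divide_distrib algebra_simps)
  then show ?case
    using cdf_Sup_sublevel[of "real (Suc j) / real N"] Suc.prems assms(1) by auto
qed

lemma quantile_pos_gap:
  assumes "1 \<le> N" "j < N"
  shows "2 / real N \<le> quantile_pos \<mu> \<rho> N (Suc j) - quantile_pos \<mu> \<rho> N j"
proof -
  let ?x = "quantile_pos \<mu> \<rho> N"
  have F: "cdf \<mu> (?x (Suc j)) - cdf \<mu> (?x j) = 1 / real N"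
    using cdf_quantile_pos[of N j] cdf_quantile_pos[of N "Suc j"] assms
    by (simp add: add_divide_distrib)
  then have "cdf \<mu> (?x j) < cdf \<mu> (?x (Suc j))" 
    using assms by (smt (verit) of_nat_0_less_iff zero_less_divide_1_iff less_le_trans zero_less_one)
  then have "?x j \<le> ?x (Suc j)" using cdf_nondecreasing[of "?x (Suc j)" "?x j"] by linarith
  from cdf_increment_le[OF this] F show ?thesis by simp
qed

end

section \<open>The discretised initial densities\<close>

context half_bounded_density
begin

abbreviation "inf_supp \<equiv> Inf (measure_support \<mu>)"
abbreviation "sup_supp \<equiv> Sup (measure_support \<mu>)"

lemma quantile_coarse_grid: "1 \<le> N \<Longrightarrow> coarse_grid N (quantile_pos \<mu> \<rho> N)"
  by unfold_locales (assumption, rule quantile_pos_gap)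

lemma quantile_range:
  assumes "1 \<le> N"
  shows "quantile_pos \<mu> \<rho> N N - quantile_pos \<mu> \<rho> N 0 \<le> sup_supp - inf_supp"
  using cdf_quantile_pos[of N N] assms by simp

lemma initial_density_0: "initial_density \<mu> \<rho> 0 = (\<lambda>x. 0)"
  by (auto simp: initial_density_def eulerian_density_def)

lemma initial_density_bounds:
  "\<bar>initial_density \<mu> \<rho> N z\<bar> \<le> 1 * indicator {inf_supp..sup_supp} z"
proof (cases "N = 0")
  case False
  then interpret coarse_grid N "quantile_pos \<mu> \<rho> N" by (intro quantile_coarse_grid) auto
  have "z \<notin> {y 0..<y N}" if "z \<notin> {inf_supp..sup_supp}"
    using that cdf_quantile_pos[of N N] N_pos by auto
  then show ?thesis
    using eulerian_density_nonneg[of z] density_le_1[of z] eulerian_density_outside[of z]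
    by (cases "z \<in> {inf_supp..sup_supp}") (auto simp: initial_density_def)
qed (simp add: initial_density_0)

text \<open>An even node is a quantile, so \<open>F\<close> is exact there. An odd node, moved to a midpoint, stays between
  its neighbouring quantiles, which costs at most \<open>1/N\<close>.\<close>

lemma initial_density_cdf_close:
  assumes "1 \<le> N"
  shows "\<bar>(LINT x:{..z}|lborel. initial_density \<mu> \<rho> N x) - cdf \<mu> z\<bar> \<le> 2 / real N"
proof -
  interpret coarse_grid N "quantile_pos \<mu> \<rho> N" using assms by (rule quantile_coarse_grid)
  let ?x = "quantile_pos \<mu> \<rho> N"
  have "\<bar>cdf \<mu> (y j) - real j / real N\<bar> \<le> 1 / real N" if j: "j \<le> N" for j
  proof (cases "even j \<or> j = N")
    case True
    then have "y j = ?x j" by auto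
    then show ?thesis using cdf_quantile_pos[OF assms j] by simp
  next
    case False
    then obtain i where i: "j = Suc i" "i < N" using j by (cases j) auto
    have "?x i \<le> ?x j" using quantile_pos_gap[OF assms i(2)] assms i by (smt (verit) divide_nonneg_nonneg of_nat_0_le_iff)
    then have "cdf \<mu> (?x i) \<le> cdf \<mu> (y j)" "cdf \<mu> (y j) \<le> cdf \<mu> (?x j)"
      using False i by (auto simp: y_odd intro!: cdf_nondecreasing)
    moreover have "cdf \<mu> (?x i) = real i / real N" "cdf \<mu> (?x j) = real j / real N"
      using cdf_quantile_pos[OF assms, of i] cdf_quantile_pos[OF assms, of j] i j by auto
    moreover have "real j / real N = real i / real N + 1 / real N"
      using i by (simp add: add_divide_distrib)
    ultimately show ?thesis by auto
  qed
  from eulerian_density_cdf_close[of "cdf \<mu>" "1 / real N" z, OF _ _ _ this]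
  show ?thesis using cdf_nondecreasing cdf_nonneg cdf_bounded_prob
    by (simp add: initial_density_def)
qed

lemma initial_density_weak_star: "weak_star_tendsto (initial_density \<mu> \<rho>) \<rho>"
proof (rule weak_star_tendstoI)
  show "initial_density \<mu> \<rho> N \<in> borel_measurable borel" for N
    unfolding initial_density_def eulerian_density_def by measurable
  show "\<bar>initial_density \<mu> \<rho> N z\<bar> \<le> 1 * indicator {inf_supp..sup_supp} z" for N z
    by (rule initial_density_bounds)
  show "AE x in lborel. \<bar>\<rho> x\<bar> \<le> 1"
    using rho_nonneg rho_le_half by eventually_elim auto
  show "(\<lambda>N. LINT x|lborel. initial_density \<mu> \<rho> N x) \<longlonglongrightarrow> (LINT x|lborel. \<rho> x)"
  proof (rule tendsto_eventually, rule eventually_sequentiallyI)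
    fix N :: nat assume "1 \<le> N"
    then interpret coarse_grid N "quantile_pos \<mu> \<rho> N" by (rule quantile_coarse_grid)
    show "(LINT x|lborel. initial_density \<mu> \<rho> N x) = (LINT x|lborel. \<rho> x)"
      by (simp add: initial_density_def eulerian_density_total integral_rho)
  qed
  show "(\<lambda>N. LINT x:{..z}|lborel. initial_density \<mu> \<rho> N x) \<longlonglongrightarrow> (LINT x:{..z}|lborel. \<rho> x)" for z
    unfolding set_integral_rho_atMost
  proof (rule LIM_zero_cancel, rule Lim_null_comparison)
    show "\<forall>\<^sub>F N in sequentially. norm ((LINT x:{..z}|lborel. initial_density \<mu> \<rho> N x) - cdf \<mu> z) \<le> 2 / real N"
      using initial_density_cdf_close by (intro eventually_sequentiallyI[of 1]) auto
    show "(\<lambda>N. 2 / real N) \<longlonglongrightarrow> 0"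
      by (rule lim_const_over_n)
  qed
qed (rule rho_integrable)

lemma initial_density_L1_ge:
  assumes "2 \<le> N"
  shows "ennreal (1 / (3 * (3 * (sup_supp - inf_supp) + 1)))
    \<le> (\<integral>\<^sup>+ x. ennreal \<bar>initial_density \<mu> \<rho> N x - \<rho> x\<bar> \<partial>lborel)"
proof -
  have N: "1 \<le> N" using assms by simp
  interpret coarse_grid N "quantile_pos \<mu> \<rho> N" using N by (rule quantile_coarse_grid)
  have "1 / (3 * (3 * (sup_supp - inf_supp) + 1)) \<le> (LINT z|lborel. \<bar>f z - \<rho> z\<bar>)"
    using assms quantile_range[OF N] rho_integrable cdf_quantile_pos[OF N]
    by (intro L1_distance_ge) (auto simp: set_integral_rho_atMost)
  moreover have "(\<integral>\<^sup>+ x. ennreal \<bar>f x - \<rho> x\<bar> \<partial>lborel) = ennreal (LINT z|lborel. \<bar>f z - \<rho> z\<bar>)"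
    using rho_integrable eulerian_density_integrable by (intro nn_integral_eq_integral) auto
  ultimately show ?thesis by (simp add: initial_density_def ennreal_leI)
qed

lemma inf_supp_le_sup_supp: "inf_supp \<le> sup_supp"
  using support_nonempty support_bounds by (meson all_not_in_conv order_trans)

text \<open>The \<open>k\<close>-th member of a strictly increasing sequence is at least \<open>k\<close>, so the uniform lower bound
  for \<open>N \<ge> 2\<close> applies to all but two terms.\<close>

lemma initial_density_not_L1_tendsto:
  assumes "strict_mono Nk"
  shows "\<not> L1_tendsto (\<lambda>k. initial_density \<mu> \<rho> (Nk k)) \<rho>"
proof
  let ?c = "1 / (3 * (3 * (sup_supp - inf_supp) + 1))"
  assume "L1_tendsto (\<lambda>k. initial_density \<mu> \<rho> (Nk k)) \<rho>"
  then have "(\<lambda>k. \<integral>\<^sup>+ x. ennreal \<bar>initial_density \<mu> \<rho> (Nk k) x - \<rho> x\<bar> \<partial>lborel) \<longlonglongrightarrow> 0"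
    by (simp add: L1_tendsto_def)
  moreover have "ennreal ?c \<le> (\<integral>\<^sup>+ x. ennreal \<bar>initial_density \<mu> \<rho> (Nk k) x - \<rho> x\<bar> \<partial>lborel)"
    if "2 \<le> k" for k
    using that seq_suble[OF assms, of k] by (intro initial_density_L1_ge) simp
  ultimately have "ennreal ?c \<le> 0"
    by (intro tendsto_lowerbound) (auto intro: eventually_sequentiallyI)
  moreover have "0 < ?c" using inf_supp_le_sup_supp by (intro divide_pos_pos mult_pos_pos) auto
  ultimately show False by simp
qed

lemma initial_density_total_variation_unbounded:
  "\<exists>N\<ge>1. ennreal C < total_variation (initial_density \<mu> \<rho> N)"
proof -
  let ?L = "sup_supp - inf_supp"
  have K: "0 < (3 * ?L + 2)\<^sup>2" using inf_supp_le_sup_supp by simp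
  \<comment> \<open>The absolute value covers negative \<open>C\<close>, which \<^const>\<open>ennreal\<close> sends to \<open>0\<close>.\<close>
  obtain m :: nat where m: "\<bar>C\<bar> * (3 * ?L + 2)\<^sup>2 < real m" using reals_Archimedean2 by blast
  have "0 \<le> \<bar>C\<bar> * (3 * ?L + 2)\<^sup>2" by simp
  with m have m_pos: "0 < m" using of_nat_0_less_iff by (metis le_less_trans)
  define N where "N = 2 * m"
  have N: "2 \<le> N" "1 \<le> N" using m_pos by (auto simp: N_def)
  interpret coarse_grid N "quantile_pos \<mu> \<rho> N" using N(2) by (rule quantile_coarse_grid)
  have "\<bar>C\<bar> < real m / (3 * ?L + 2)\<^sup>2" using m K by (subst pos_less_divide_eq) auto
  then have "C < 8 * (real m / (3 * ?L + 2)\<^sup>2)" "0 < 8 * (real m / (3 * ?L + 2)\<^sup>2)" by auto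
  then have "ennreal C < ennreal (8 * (real m / (3 * ?L + 2)\<^sup>2))"
    by (intro ennreal_lessI)
  also have "\<dots> \<le> total_variation (initial_density \<mu> \<rho> N)"
    using total_variation_ge[OF N(1) quantile_range[OF N(2)]]
    by (simp add: initial_density_def N_def)
  finally show ?thesis using N(2) by blast
qed

end

theorem proposition4p6:
  fixes \<mu> :: "real measure" and \<rho> v :: "real \<Rightarrow> real"
  assumes "\<mu> \<in> prob_compact_support"
    and "is_density \<mu> \<rho>" and "Linfty_norm \<rho> \<le> ereal (1 / 2)"
    and "V1 v"
  shows "weak_star_tendsto (initial_density \<mu> \<rho>) \<rho> \<and>
    (\<forall>Nk :: nat \<Rightarrow> nat. strict_mono Nk \<and> (\<forall>k. 1 \<le> Nk k) \<longrightarrow>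
       \<not> L1_tendsto (\<lambda>k. initial_density \<mu> \<rho> (Nk k)) \<rho>) \<and>
    (\<nexists>C :: real. \<forall>N\<ge>1. total_variation (initial_density \<mu> \<rho> N) \<le> ennreal C)"
proof -
  interpret half_bounded_density \<mu> \<rho> using assms(1-3) by unfold_locales
  show ?thesis
    using initial_density_weak_star initial_density_not_L1_tendsto
      initial_density_total_variation_unbounded by (meson not_less)
qed

end
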